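(* The minimum density of a $2$-identifying code of the hex grid $G_H$ is at least $1/5$; that is, every $2$-identifying code $C$ of $G_H$ satisfies $D(C)\ge \frac15$.
   Context: The hex grid $G_H$ (in its "brick wall" representation) is the graph with vertex set $V(G_H)=\mathbb{Z}\times\mathbb{Z}$ and edge set $E(G_H)=\{\{u,v\}: u=(i,j),\ u-v\in\{(0,(-1)^{i+j+1}),(1,0),(-1,0)\}\}$, subtraction being coordinatewise. For a connected undirected graph $G$ with graph distance $d$, $B_r(v)=\{u\in V(G): d(u,v)\le r\}$. A set $C\subseteq V(G)$ is an $r$-identifying code of $G$ if (1) $B_r(v)\cap C\ne\emptyset$ for every $v\in V(G)$, and (2) $B_r(u)\cap C\neq B_r(v)\cap C$ for all $u\ne v$ in $V(G)$. For a code $C$ in a graph with vertex set $\mathbb{Z}\times\mathbb{Z}$, let $Q_m=\{(x,y)\in\mathbb{Z}\times\mathbb{Z}: |x|\le m,\ |y|\le m\}$; the density of $C$ is $D(C)=\limsup_{m\to\infty}\frac{|C\cap Q_m|}{|Q_m|}$. *)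

theory Defs
  imports Complex_Main "HOL-Library.Extended_Nat" "HOL-Library.Extended_Real"
begin

text \<open>An undirected graph is given by a vertex set \<open>V\<close> and an edge set \<open>E\<close> of unordered pairs
  \<open>{u, v}\<close> with \<open>u, v \<in> V\<close>.\<close>

definition adj :: "'a set set \<Rightarrow> ('a \<times> 'a) set" where
  "adj E = {(u, v). {u, v} \<in> E}"

text \<open>The distance is the least length of a walk, and \<open>\<infinity>\<close> if there is no walk
  (the infimum of the empty set in \<open>enat\<close>).\<close>

definition graph_dist :: "'a set set \<Rightarrow> 'a \<Rightarrow> 'a \<Rightarrow> enat" where
  "graph_dist E u v = (INF n \<in> {n. (u, v) \<in> adj E ^^ n}. enat n)"

definition graph_ball :: "'a set \<Rightarrow> 'a set set \<Rightarrow> nat \<Rightarrow> 'a \<Rightarrow> 'a set" where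
  "graph_ball V E r v = {u \<in> V. graph_dist E u v \<le> enat r}"

definition identifying_code :: "'a set \<Rightarrow> 'a set set \<Rightarrow> nat \<Rightarrow> 'a set \<Rightarrow> bool" where
  "identifying_code V E r C \<longleftrightarrow>
     C \<subseteq> V \<and>
     (\<forall>v\<in>V. graph_ball V E r v \<inter> C \<noteq> {}) \<and>
     (\<forall>u\<in>V. \<forall>v\<in>V. u \<noteq> v \<longrightarrow> graph_ball V E r u \<inter> C \<noteq> graph_ball V E r v \<inter> C)"

definition hex_vertices :: "(int \<times> int) set" where
  "hex_vertices = UNIV"

text \<open>The conditional is \<open>(-1)\<close> to the power \<open>i + j + 1\<close>, whose exponent may be negative.\<close>

definition hex_edges :: "(int \<times> int) set set" where
  "hex_edges =
     {{(i, j), (k, l)} | i j k l.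
        (i - k, j - l) \<in> {(0, if even (i + j + 1) then 1 else -1), (1, 0), (-1, 0)}}"

definition square_box :: "nat \<Rightarrow> (int \<times> int) set" where
  "square_box m = {(x, y). \<bar>x\<bar> \<le> int m \<and> \<bar>y\<bar> \<le> int m}"

definition density :: "(int \<times> int) set \<Rightarrow> ereal" where
  "density C = limsup (\<lambda>m. ereal (real (card (C \<inter> square_box m)) / real (card (square_box m))))"

text \<open>The hex grid is a connected graph without loops, so all its distances are finite.\<close>

lemma card_hex_edge: "e \<in> hex_edges \<Longrightarrow> card e = 2"
  by (auto simp: hex_edges_def card_insert_if split: if_splits)

lemma sym_adj: "sym (adj E)"
  by (auto simp: adj_def sym_def insert_commute)

lemma hex_adj_iff:
  "((i, j), (k, l)) \<in> adj hex_edges \<longleftrightarrow>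
     (i - k, j - l) \<in> {(0, if even (i + j + 1) then 1 else -1), (1, 0), (-1, 0)}"
proof
  assume "((i, j), (k, l)) \<in> adj hex_edges"
  then obtain i' j' k' l' where e: "{(i, j), (k, l)} = {(i', j'), (k', l')}"
    and d: "(i' - k', j' - l') \<in> {(0, if even (i' + j' + 1) then 1 else -1), (1, 0), (-1, 0)}"
    unfolding adj_def hex_edges_def by blast
  from e consider "i' = i" "j' = j" "k' = k" "l' = l" | "i' = k" "j' = l" "k' = i" "l' = j"
    by (auto simp: doubleton_eq_iff)
  then show "(i - k, j - l) \<in> {(0, if even (i + j + 1) then 1 else -1), (1, 0), (-1, 0)}"
  proof cases
    case 1
    with d show ?thesis by simp
  next
    case 2
    with d have "(k - i, l - j) \<in> {(0, if even (k + l + 1) then 1 else -1), (1, 0), (-1, 0)}"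
      by simp
    then consider "i = k" "even (k + l + 1)" "j = l - 1" | "i = k" "odd (k + l + 1)" "j = l + 1"
      | "i = k - 1" "j = l" | "i = k + 1" "j = l"
      by (fastforce split: if_splits)
    then show ?thesis by cases auto
  qed
next
  assume "(i - k, j - l) \<in> {(0, if even (i + j + 1) then 1 else -1), (1, 0), (-1, 0)}"
  then show "((i, j), (k, l)) \<in> adj hex_edges"
    unfolding adj_def hex_edges_def by blast
qed

lemma hex_connected: "(u, v) \<in> (adj hex_edges)\<^sup>*"
proof -
  let ?R = "adj hex_edges"
  have sym: "sym (?R\<^sup>*)"
    by (simp add: sym_adj sym_rtrancl)
  have right: "((i, j), (i + 1, j)) \<in> ?R\<^sup>*" for i j
    by (rule r_into_rtrancl) (simp add: hex_adj_iff)
  have up: "((i, j), (i, j + 1)) \<in> ?R\<^sup>*" for i j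
  proof (cases "even (i + j)")
    case True
    then show ?thesis
      by (intro r_into_rtrancl) (simp add: hex_adj_iff)
  next
    case False
    then have "((i + 1, j), (i + 1, j + 1)) \<in> ?R\<^sup>*"
      by (intro r_into_rtrancl) (auto simp: hex_adj_iff)
    with right[of i j] symD[OF sym right[of i "j + 1"]] show ?thesis
      by (meson rtrancl_trans)
  qed
  have horizontal: "((i, j), (0, j)) \<in> ?R\<^sup>*" for i j
  proof (induction i rule: int_induct[where k = 0])
    case base
    then show ?case by simp
  next
    case (step1 i)
    then show ?case using symD[OF sym right[of i j]] by (meson rtrancl_trans)
  next
    case (step2 i)
    then show ?case using right[of "i - 1" j] by (metis diff_add_cancel rtrancl_trans)
  qed
  have vertical: "((0, j), (0, 0)) \<in> ?R\<^sup>*" for j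
  proof (induction j rule: int_induct[where k = 0])
    case base
    then show ?case by simp
  next
    case (step1 j)
    then show ?case using symD[OF sym up[of 0 j]] by (meson rtrancl_trans)
  next
    case (step2 j)
    then show ?case using up[of 0 "j - 1"] by (metis diff_add_cancel rtrancl_trans)
  qed
  have "(w, (0, 0)) \<in> ?R\<^sup>*" for w
    using horizontal[of "fst w" "snd w"] vertical[of "snd w"] by (cases w) (auto intro: rtrancl_trans)
  then show ?thesis
    using sym by (meson rtrancl_trans symD)
qed

lemma hex_dist_finite: "graph_dist hex_edges u v \<noteq> \<infinity>"
proof -
  obtain n where "(u, v) \<in> adj hex_edges ^^ n"
    using hex_connected[of u v] by (auto simp: rtrancl_power)
  then have "graph_dist hex_edges u v \<le> enat n"
    unfolding graph_dist_def by (intro INF_lower) simp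
  then show ?thesis
    by (cases "graph_dist hex_edges u v") simp_all
qed

end

theory Submission
  imports Defs "HOL-Real_Asymp.Real_Asymp"
begin

text \<open>Write \<open>I v\<close> for the part of the code in the ball of radius \<open>2\<close> around \<open>v\<close>. Every \<open>v\<close> satisfies
  \<open>3 \<le> card (I v) + 2 [card (I v) = 1] + [card (I v) = 2]\<close>. Summed over a box, the right-hand side
  is charged to the codewords: each lies in at most \<open>10\<close> balls, it is the only element of at most one
  \<open>I v\<close>, and it lies in at most \<open>6\<close> two-element sets \<open>I v\<close>. Hence the box has at most
  \<open>(10 + 2 + 6 / 2) / 3 = 5\<close> vertices per codeword, up to boundary effects.

  For the bound \<open>6\<close>, the vertices \<open>v\<close> with \<open>I v = {c, x}\<close> lie in the ball around \<open>c\<close>, and the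
  partner \<open>x\<close> is in the ball of no other such vertex. Only this irredundancy is used.\<close>

section \<open>Balls of radius two in a loopless graph of degree at most three\<close>

locale cubic_graph =
  fixes N :: "'a \<Rightarrow> 'a set"
  assumes sym: "u \<in> N v \<Longrightarrow> v \<in> N u"
    and irrefl: "v \<notin> N v"
    and cubic: "\<exists>x y z. N v = {x, y, z}"
begin

definition ball2 :: "'a \<Rightarrow> 'a set" where
  "ball2 v = {u. \<exists>w. (w = v \<or> w \<in> N v) \<and> (u = w \<or> u \<in> N w)}"

lemma ball2_sym: "u \<in> ball2 v \<Longrightarrow> v \<in> ball2 u"
  unfolding ball2_def using sym by blast

lemma ball2_step: "u \<in> N v \<Longrightarrow> u \<in> ball2 v"
  unfolding ball2_def by blast

lemma ball2_step2: "w \<in> N v \<Longrightarrow> u \<in> N w \<Longrightarrow> u \<in> ball2 v"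
  unfolding ball2_def by blast

lemma neighbours_from: "c \<in> N v \<Longrightarrow> \<exists>a b. N v = {c, a, b}"
  using cubic[of v] by (metis empty_iff insert_commute insert_iff)

text \<open>These names split the ball around \<open>c\<close> into \<open>c\<close> itself and
  three arms, each a neighbour of \<open>c\<close> with its own further neighbours. The names may
  coincide, so arms may overlap or even contain \<open>c\<close>; cardinalities are therefore only
  bounded from above.\<close>

lemma ball2_shape:
  obtains n1 n2 n3 a1 a2 a3 b1 b2 b3 where
    "N c = {n1, n2, n3}" "N n1 = {c, a1, b1}" "N n2 = {c, a2, b2}" "N n3 = {c, a3, b3}"
proof -
  obtain n1 n2 n3 where n: "N c = {n1, n2, n3}"
    using cubic by blast
  then have "c \<in> N n1" "c \<in> N n2" "c \<in> N n3"
    using sym by auto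
  with n that show thesis
    using neighbours_from by metis
qed

lemma ball2_eq:
  assumes "N c = {n1, n2, n3}" "N n1 = {c, a1, b1}" "N n2 = {c, a2, b2}" "N n3 = {c, a3, b3}"
  shows "ball2 c = {c} \<union> {n1, a1, b1} \<union> {n2, a2, b2} \<union> {n3, a3, b3}"
proof -
  have "ball2 c = {c} \<union> N c \<union> \<Union>(N ` N c)"
    unfolding ball2_def by blast
  also have "\<Union>(N ` N c) = N n1 \<union> N n2 \<union> N n3"
    unfolding assms(1) by blast
  finally show ?thesis
    unfolding assms by blast
qed

lemma finite_ball2: "finite (ball2 v)"
proof (rule ball2_shape)
  show "finite (ball2 v)"
    if "N v = {n1, n2, n3}" "N n1 = {v, a1, b1}" "N n2 = {v, a2, b2}" "N n3 = {v, a3, b3}"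
    for n1 n2 n3 a1 a2 a3 b1 b2 b3
    unfolding ball2_eq[OF that] by simp
qed

lemma card_ball2: "card (ball2 v) \<le> 10"
proof (rule ball2_shape)
  show "card (ball2 v) \<le> 10"
    if "N v = {n1, n2, n3}" "N n1 = {v, a1, b1}" "N n2 = {v, a2, b2}" "N n3 = {v, a3, b3}"
    for n1 n2 n3 a1 a2 a3 b1 b2 b3
  proof -
    have "ball2 v = set [v, n1, a1, b1, n2, a2, b2, n3, a3, b3]"
      unfolding ball2_eq[OF that] by auto
    then show ?thesis
      using card_length[of "[v, n1, a1, b1, n2, a2, b2, n3, a3, b3]"] by simp
  qed
qed

text \<open>Members of one arm are equal or adjacent to its root \<open>n\<close>, hence pairwise at
  distance at most two.\<close>

lemma arm_in_ball2:
  assumes "N n = {c, a, b}" "u \<in> {n, a, b}" "v \<in> {n, a, b}"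
  shows "u \<in> ball2 v"
proof -
  have "a \<in> N n" "b \<in> N n"
    using assms(1) by auto
  with assms(2,3) show ?thesis
    unfolding ball2_def using sym by blast
qed

section \<open>Irredundant subsets of a ball\<close>

definition irredundant :: "'a \<Rightarrow> 'a set \<Rightarrow> bool" where
  "irredundant c S \<longleftrightarrow> S \<subseteq> ball2 c \<and>
     (\<forall>v\<in>S. \<exists>x \<in> ball2 v. x \<noteq> c \<and> (\<forall>w\<in>S. w \<noteq> v \<longrightarrow> x \<notin> ball2 w))"

text \<open>The balls around \<open>a1\<close> and \<open>b1\<close> cover so much of the ball
  around \<open>n1\<close> that a private vertex of \<open>n1\<close> must be \<open>n2\<close> or
  \<open>n3\<close>. Such a vertex is close to \<open>c\<close> and to most of the other two arms,
  so these cannot lie in \<open>S\<close>.\<close>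

lemma card_irredundant_full_arm:
  assumes N: "N c = {n1, n2, n3}" "N n1 = {c, a1, b1}" "N n2 = {c, a2, b2}" "N n3 = {c, a3, b3}"
    and S: "irredundant c S" and arm: "{n1, a1, b1} \<subseteq> S"
  shows "card S \<le> 5"
proof -
  have sub: "S \<subseteq> {c} \<union> {n1, a1, b1} \<union> {n2, a2, b2} \<union> {n3, a3, b3}"
    using S ball2_eq[OF N] unfolding irredundant_def by blast
  obtain x where x: "x \<in> ball2 n1" "x \<noteq> c" and priv: "\<And>w. w \<in> S \<Longrightarrow> w \<noteq> n1 \<Longrightarrow> x \<notin> ball2 w"
    using S arm unfolding irredundant_def by (metis insert_subset)
  have "a1 \<noteq> n1" "b1 \<noteq> n1"
    using irrefl[of n1] N(2) by auto
  then have "x \<notin> ball2 a1" "x \<notin> ball2 b1"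
    using priv arm by auto
  then have "x \<notin> {n1, a1, b1} \<union> N a1 \<union> N b1"
    using arm_in_ball2[OF N(2)] ball2_step by blast
  \<comment> \<open>The ball around \<open>n1\<close> is sorted by the neighbour of
    \<open>n1\<close> passed through. All but the part through \<open>c\<close> has just been
    excluded.\<close>
  moreover have "x \<in> {n1, c, a1, b1} \<union> N c \<union> N a1 \<union> N b1"
    using x(1) N(2) unfolding ball2_def by auto
  ultimately consider "x = n2" | "x = n3"
    using x(2) N(1) by auto
  then show ?thesis
  proof cases
    case 1
    have "n2 \<in> ball2 c" "n2 \<in> ball2 n3"
      by (rule ball2_step, use N(1) in blast) (rule ball2_step2[of c], use N in auto)
    then have "n2 \<in> ball2 u" if "u \<in> {c, n3, n2, a2, b2}" for u
      using that arm_in_ball2[OF N(3), of n2 u] by blast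
    \<comment> \<open>Since \<open>x\<close> is private to \<open>n1\<close>, any member of
      \<open>S\<close> having \<open>x\<close> in its ball equals \<open>n1\<close>; the right-hand
      side allows for coinciding names.\<close>
    then have "S \<inter> {c, n3, n2, a2, b2} \<subseteq> {n1}"
      using priv 1 by blast
    then have "S \<subseteq> {n1, a1, b1, a3, b3}"
      using sub by blast
    then have "card S \<le> card {n1, a1, b1, a3, b3}"
      by (intro card_mono) auto
    also have "\<dots> \<le> 5"
      by (simp add: card_insert_if)
    finally show ?thesis .
  next
    case 2
    have "n3 \<in> ball2 c" "n3 \<in> ball2 n2"
      by (rule ball2_step, use N(1) in blast) (rule ball2_step2[of c], use N in auto)
    then have "n3 \<in> ball2 u" if "u \<in> {c, n2, n3, a3, b3}" for u
      using that arm_in_ball2[OF N(4), of n3 u] by blast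
    then have "S \<inter> {c, n2, n3, a3, b3} \<subseteq> {n1}"
      using priv 2 by blast
    then have "S \<subseteq> {n1, a1, b1, a2, b2}"
      using sub by blast
    then have "card S \<le> card {n1, a1, b1, a2, b2}"
      by (intro card_mono) auto
    also have "\<dots> \<le> 5"
      by (simp add: card_insert_if)
    finally show ?thesis .
  qed
qed

lemma card_Int_arm:
  fixes n a b :: 'a
  assumes "\<not> {n, a, b} \<subseteq> S"
  shows "card (S \<inter> {n, a, b}) \<le> 2"
proof -
  have le2: "card U \<le> 2" if "U \<subseteq> {x, y}" for U and x y :: 'a
  proof -
    have "card U \<le> card {x, y}"
      using that by (intro card_mono) auto
    also have "\<dots> \<le> 2"
      by (simp add: card_insert_if)
    finally show ?thesis .
  qed
  have "S \<inter> {n, a, b} \<subseteq> {a, b} \<or> S \<inter> {n, a, b} \<subseteq> {n, b} \<or> S \<inter> {n, a, b} \<subseteq> {n, a}"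
    using assms by auto
  then show ?thesis
    by (elim disjE) (erule le2)+
qed

text \<open>A full arm already forces at most 5. Otherwise each arm contributes at most 2, giving 6
  without \<open>c\<close>. If \<open>c\<close> is in \<open>S\<close>, its private vertex excludes
  an entire arm, leaving at most 1 + 2 + 2.\<close>

lemma card_irredundant:
  assumes S: "irredundant c S"
  shows "card S \<le> 6"
proof -
  obtain n1 n2 n3 a1 a2 a3 b1 b2 b3 where
    N: "N c = {n1, n2, n3}" "N n1 = {c, a1, b1}" "N n2 = {c, a2, b2}" "N n3 = {c, a3, b3}"
    by (rule ball2_shape)
  \<comment> \<open>Reorderings that let the full-arm bound be applied to the second and third
    arms.\<close>
  have N': "N c = {n2, n1, n3}" "N c = {n3, n1, n2}"
    using N(1) by auto
  let ?T1 = "{n1, a1, b1}" and ?T2 = "{n2, a2, b2}" and ?T3 = "{n3, a3, b3}"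
  have ball: "ball2 c = {c} \<union> ?T1 \<union> ?T2 \<union> ?T3"
    by (rule ball2_eq[OF N])
  have "S \<subseteq> ball2 c"
    using S unfolding irredundant_def by blast
  then have sub: "S \<subseteq> {c} \<union> ?T1 \<union> ?T2 \<union> ?T3"
    unfolding ball .
  show ?thesis
  proof (cases "?T1 \<subseteq> S \<or> ?T2 \<subseteq> S \<or> ?T3 \<subseteq> S")
    case True
    then have "card S \<le> 5"
      using card_irredundant_full_arm[OF N S]
        card_irredundant_full_arm[OF N'(1) N(3) N(2) N(4) S]
        card_irredundant_full_arm[OF N'(2) N(4) N(2) N(3) S] by blast
    then show ?thesis by simp
  next
    case False
    have two: "card (S \<inter> ?T1) \<le> 2" "card (S \<inter> ?T2) \<le> 2" "card (S \<inter> ?T3) \<le> 2"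
      by (rule card_Int_arm, use False in blast)+
    show ?thesis
    proof (cases "c \<in> S")
      case False
      then have "S = S \<inter> ?T1 \<union> S \<inter> ?T2 \<union> S \<inter> ?T3"
        using sub by blast
      then have "card S = card (S \<inter> ?T1 \<union> S \<inter> ?T2 \<union> S \<inter> ?T3)"
        by (rule arg_cong)
      then show ?thesis
        using two card_Un_le[of "S \<inter> ?T1 \<union> S \<inter> ?T2" "S \<inter> ?T3"]
          card_Un_le[of "S \<inter> ?T1" "S \<inter> ?T2"] by linarith
    next
      case True
      have key: "card S \<le> 5"
        if "S \<subseteq> {c} \<union> T \<union> U" "card (S \<inter> T) \<le> 2" "card (S \<inter> U) \<le> 2" for T U
      proof -
        have "S = {c} \<union> S \<inter> T \<union> S \<inter> U"
          using that(1) True by blast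
        then have "card S = card ({c} \<union> S \<inter> T \<union> S \<inter> U)"
          by (rule arg_cong)
        moreover have "card {c} = 1"
          by simp
        ultimately show ?thesis
          using that(2,3) card_Un_le[of "{c} \<union> S \<inter> T" "S \<inter> U"]
            card_Un_le[of "{c}" "S \<inter> T"] by linarith
      qed
      obtain x where x: "x \<in> ball2 c" "x \<noteq> c"
        and priv: "\<And>w. w \<in> S \<Longrightarrow> w \<noteq> c \<Longrightarrow> x \<notin> ball2 w"
        using S True unfolding irredundant_def by metis
      \<comment> \<open>The arm containing \<open>x\<close> lies in the ball around
        \<open>x\<close>, so by privacy none of its vertices other than \<open>c\<close> belongs to
        \<open>S\<close>.\<close>
      consider "x \<in> ?T1" | "x \<in> ?T2" | "x \<in> ?T3"
        using x ball by auto
      then have "card S \<le> 5"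
      proof cases
        case 1
        then have "S \<inter> ?T1 \<subseteq> {c}"
          using arm_in_ball2[OF N(2) 1] priv by blast
        then have "S \<subseteq> {c} \<union> ?T2 \<union> ?T3"
          using sub by blast
        then show ?thesis using two by (intro key)
      next
        case 2
        then have "S \<inter> ?T2 \<subseteq> {c}"
          using arm_in_ball2[OF N(3) 2] priv by blast
        then have "S \<subseteq> {c} \<union> ?T1 \<union> ?T3"
          using sub by blast
        then show ?thesis using two by (intro key)
      next
        case 3
        then have "S \<inter> ?T3 \<subseteq> {c}"
          using arm_in_ball2[OF N(4) 3] priv by blast
        then have "S \<subseteq> {c} \<union> ?T1 \<union> ?T2"
          using sub by blast
        then show ?thesis using two by (intro key)
      qed
      then show ?thesis by simp
    qed
  qed
qed

section \<open>Charging vertices to codewords\<close>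

lemma card_pairs_at_codeword:
  assumes inj: "inj (\<lambda>v. ball2 v \<inter> C)" and c: "c \<in> C"
  shows "card {v. c \<in> ball2 v \<and> card (ball2 v \<inter> C) = 2} \<le> 6"
proof (rule card_irredundant)
  let ?S = "{v. c \<in> ball2 v \<and> card (ball2 v \<inter> C) = 2}"
  have pair: "\<exists>x. x \<noteq> c \<and> ball2 v \<inter> C = {c, x}" if "v \<in> ?S" for v
  proof -
    have "c \<in> ball2 v \<inter> C" "card (ball2 v \<inter> C) = 2"
      using that c by auto
    then obtain x where "ball2 v \<inter> C - {c} = {x}"
      by (metis One_nat_def card_1_singletonE card_Diff_singleton diff_Suc_1 numeral_2_eq_2)
    with \<open>c \<in> ball2 v \<inter> C\<close> show ?thesis
      by blast
  qed
  have "\<exists>x \<in> ball2 v. x \<noteq> c \<and> (\<forall>w\<in>?S. w \<noteq> v \<longrightarrow> x \<notin> ball2 w)" if v: "v \<in> ?S" for v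
  proof -
    obtain x where x: "x \<noteq> c" "ball2 v \<inter> C = {c, x}"
      using pair[OF v] by blast
    \<comment> \<open>The partner \<open>x\<close> is the private vertex: if it also lay in the ball
      around \<open>w\<close>, both vertices would have the code part \<open>{c, x}\<close>,
      contradicting injectivity.\<close>
    have "w = v" if w: "w \<in> ?S" "x \<in> ball2 w" for w
    proof -
      obtain y where y: "ball2 w \<inter> C = {c, y}"
        using pair[OF w(1)] by blast
      moreover have "x \<in> ball2 w \<inter> C"
        using w(2) x(2) by blast
      ultimately have "ball2 w \<inter> C = {c, x}"
        using x(1) by blast
      with x(2) show ?thesis
        by (intro injD[OF inj, of w v]) simp
    qed
    with x show ?thesis by blast
  qed
  then show "irredundant c ?S"
    unfolding irredundant_def using ball2_sym by blast
qed

text \<open>Double counting of pairs of a vertex and a codeword in its ball. The larger set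
  \<open>Q'\<close> collects every codeword reached from \<open>Q\<close>, including those outside
  \<open>Q\<close>.\<close>

lemma sum_card_fibres_le:
  assumes Q: "finite Q" and Q': "\<And>v. v \<in> Q \<Longrightarrow> ball2 v \<subseteq> Q'" "finite Q'"
    and bound: "\<And>c. c \<in> C \<Longrightarrow> card {v \<in> Q. c \<in> ball2 v} \<le> k"
  shows "(\<Sum>v\<in>Q. card (ball2 v \<inter> C)) \<le> k * card (C \<inter> Q')"
proof -
  have "(\<Sum>v\<in>Q. card (ball2 v \<inter> C)) = (\<Sum>v\<in>Q. card {c \<in> C \<inter> Q'. c \<in> ball2 v})"
    using Q'(1) by (intro sum.cong refl arg_cong[where f = card]) blast
  also have "\<dots> = (\<Sum>c\<in>C \<inter> Q'. card {v \<in> Q. c \<in> ball2 v})"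
    using sum_multicount_gen[OF Q, of "C \<inter> Q'" "\<lambda>v c. c \<in> ball2 v"] Q'(2) by simp
  also have "\<dots> \<le> (\<Sum>c\<in>C \<inter> Q'. k)"
    using bound by (intro sum_mono) auto
  also have "\<dots> = k * card (C \<inter> Q')"
    by (simp add: mult.commute)
  finally show ?thesis .
qed

text \<open>With K codewords in \<open>Q'\<close>, the three charges give 3 |\<open>Q\<close>| \<le>
  10 K + 2 K + 3 K.\<close>

lemma card_le_5_code:
  assumes nonempty: "\<And>v. ball2 v \<inter> C \<noteq> {}" and inj: "inj (\<lambda>v. ball2 v \<inter> C)"
    and Q: "finite Q" and Q': "\<And>v. v \<in> Q \<Longrightarrow> ball2 v \<subseteq> Q'" "finite Q'"
  shows "card Q \<le> 5 * card (C \<inter> Q')"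
proof -
  let ?I = "\<lambda>v. ball2 v \<inter> C"
  define Q1 where "Q1 = {v \<in> Q. card (?I v) = 1}"
  define Q2 where "Q2 = {v \<in> Q. card (?I v) = 2}"
  have fin: "finite Q1" "finite Q2"
    using Q unfolding Q1_def Q2_def by auto
  have all: "(\<Sum>v\<in>Q. card (?I v)) \<le> 10 * card (C \<inter> Q')"
  proof (rule sum_card_fibres_le[OF Q Q'])
    fix c
    have "{v \<in> Q. c \<in> ball2 v} \<subseteq> ball2 c"
      using ball2_sym by blast
    then show "card {v \<in> Q. c \<in> ball2 v} \<le> 10"
      using card_mono[OF finite_ball2] card_ball2 order_trans by blast
  qed
  have "(\<Sum>v\<in>Q1. card (?I v)) \<le> 1 * card (C \<inter> Q')"
  proof (rule sum_card_fibres_le[OF fin(1) _ Q'(2)])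
    fix c assume c: "c \<in> C"
    have "?I v = {c}" if "v \<in> {v \<in> Q1. c \<in> ball2 v}" for v
    proof -
      have "c \<in> ?I v" "card (?I v) = 1"
        using that c unfolding Q1_def by auto
      then show ?thesis
        by (metis card_1_singletonE singletonD)
    qed
    \<comment> \<open>Two vertices with the same singleton code part coincide by
      injectivity.\<close>
    then have "u = v" if "u \<in> {v \<in> Q1. c \<in> ball2 v}" "v \<in> {v \<in> Q1. c \<in> ball2 v}" for u v
      using that injD[OF inj, of u v] by metis
    then show "card {v \<in> Q1. c \<in> ball2 v} \<le> 1"
      using fin(1) by (simp add: card_le_Suc0_iff_eq)
  qed (use Q' in \<open>auto simp: Q1_def\<close>)
  then have one: "card Q1 \<le> card (C \<inter> Q')"
    by (simp add: Q1_def)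
  have "(\<Sum>v\<in>Q2. card (?I v)) \<le> 6 * card (C \<inter> Q')"
  proof (rule sum_card_fibres_le[OF fin(2) _ Q'(2)])
    fix c assume c: "c \<in> C"
    have "{v. c \<in> ball2 v \<and> card (?I v) = 2} \<subseteq> ball2 c"
      using ball2_sym by blast
    then have "finite {v. c \<in> ball2 v \<and> card (?I v) = 2}"
      using finite_ball2 finite_subset by blast
    moreover have "{v \<in> Q2. c \<in> ball2 v} \<subseteq> {v. c \<in> ball2 v \<and> card (?I v) = 2}"
      unfolding Q2_def by blast
    ultimately show "card {v \<in> Q2. c \<in> ball2 v} \<le> 6"
      using card_pairs_at_codeword[OF inj c] card_mono order_trans by blast
  qed (use Q' in \<open>auto simp: Q2_def\<close>)
  then have two: "2 * card Q2 \<le> 6 * card (C \<inter> Q')"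
    by (simp add: Q2_def)
  have "3 * card Q = (\<Sum>v\<in>Q. 3)"
    by simp
  also have "\<dots> \<le> (\<Sum>v\<in>Q. card (?I v) + 2 * (if v \<in> Q1 then 1 else 0) + (if v \<in> Q2 then 1 else 0))"
  proof (rule sum_mono)
    fix v assume "v \<in> Q"
    \<comment> \<open>Covering by the code excludes cardinality 0, the only value at which the
      weighted inequality would fail.\<close>
    moreover have "card (?I v) \<noteq> 0"
      using nonempty finite_ball2 by simp
    ultimately show "3 \<le> card (?I v) + 2 * (if v \<in> Q1 then 1 else 0) + (if v \<in> Q2 then 1 else 0)"
      unfolding Q1_def Q2_def by auto
  qed
  also have "\<dots> = (\<Sum>v\<in>Q. card (?I v)) + 2 * card (Q \<inter> Q1) + card (Q \<inter> Q2)"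
    by (simp add: sum.distrib sum_distrib_left[symmetric] sum.If_cases[OF Q] Int_def)
  also have "\<dots> = (\<Sum>v\<in>Q. card (?I v)) + 2 * card Q1 + card Q2"
    unfolding Q1_def Q2_def by (simp add: Int_def)
  finally show ?thesis
    using all one two by linarith
qed

end

section \<open>The hex grid as an instance\<close>

definition hex_nbrs :: "int \<times> int \<Rightarrow> (int \<times> int) set" where
  "hex_nbrs v = {u. (u, v) \<in> adj hex_edges}"

lemma hex_nbrs_eq:
  "hex_nbrs (k, l) = {(k + 1, l), (k - 1, l), (k, if even (k + l) then l + 1 else l - 1)}"
proof -
  have "(i, j) \<in> hex_nbrs (k, l) \<longleftrightarrow>
      (i, j) \<in> {(k + 1, l), (k - 1, l), (k, if even (k + l) then l + 1 else l - 1)}" for i j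
  proof -
    \<comment> \<open>The edge condition tests the parity at \<open>(i, j)\<close>; a vertical step
      flips it, and the extra 1 turns it into the parity at \<open>(k, l)\<close>.\<close>
    have "even (i + j + 1) \<longleftrightarrow> even (k + l)" if "i = k" "j = l + 1 \<or> j = l - 1"
      using that by auto
    then show ?thesis
      unfolding hex_nbrs_def mem_Collect_eq hex_adj_iff by (auto split: if_splits)
  qed
  then show ?thesis by auto
qed

interpretation hex: cubic_graph hex_nbrs
proof
  show "v \<in> hex_nbrs u" if "u \<in> hex_nbrs v" for u v
    using that sym_adj[of hex_edges] unfolding hex_nbrs_def by (auto dest: symD)
  show "v \<notin> hex_nbrs v" for v
    by (cases v) (simp add: hex_nbrs_eq)
  show "\<exists>x y z. hex_nbrs v = {x, y, z}" for v
    by (cases v) (metis hex_nbrs_eq)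
qed

text \<open>Replacing the bound by a strict one at \<open>Suc r\<close> lets the infimum yield an
  actual walk, and handles infinite distance as well.\<close>

lemma graph_dist_le_iff: "graph_dist E u v \<le> enat r \<longleftrightarrow> (\<exists>n\<le>r. (u, v) \<in> adj E ^^ n)"
proof -
  have "graph_dist E u v \<le> enat r \<longleftrightarrow> graph_dist E u v < enat (Suc r)"
    by (cases "graph_dist E u v") auto
  also have "\<dots> \<longleftrightarrow> (\<exists>n. (u, v) \<in> adj E ^^ n \<and> n < Suc r)"
    unfolding graph_dist_def INF_less_iff by auto
  finally show ?thesis by (auto simp: less_Suc_eq_le)
qed

lemma hex_ball_eq: "graph_ball hex_vertices hex_edges 2 v = hex.ball2 v"
proof -
  have "(\<exists>n\<le>2. P n) \<longleftrightarrow> P 0 \<or> P 1 \<or> P (2::nat)" for P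
    by (auto simp: le_Suc_eq numeral_2_eq_2)
  then show ?thesis
    unfolding graph_ball_def hex_vertices_def graph_dist_le_iff hex.ball2_def hex_nbrs_def
    by (auto simp: numeral_2_eq_2)
qed

section \<open>Boxes and the density limit\<close>

lemma square_box_eq: "square_box m = {- int m..int m} \<times> {- int m..int m}"
  unfolding square_box_def by auto

lemma card_square_box: "card (square_box m) = (2 * m + 1)\<^sup>2"
proof -
  have "nat (int m + 1 - - int m) = 2 * m + 1"
    by linarith
  then show ?thesis
    unfolding square_box_eq card_cartesian_product card_atLeastAtMost_int power2_eq_square by simp
qed

text \<open>Each edge changes either coordinate by at most one.\<close>

lemma hex_ball2_subset_box:
  assumes "v \<in> square_box m"
  shows "hex.ball2 v \<subseteq> square_box (m + 2)"
proof -
  have step: "hex_nbrs w \<subseteq> square_box (Suc k)" if "w \<in> square_box k" for w k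
    using that by (cases w) (auto simp: hex_nbrs_eq square_box_eq)
  have mono: "square_box k \<subseteq> square_box (Suc k)" for k
    by (auto simp: square_box_eq)
  have "hex.ball2 v \<subseteq> square_box (Suc (Suc m))"
    unfolding hex.ball2_def using assms step mono by blast
  then show ?thesis by simp
qed

theorem theorem1:
  fixes C :: "(int \<times> int) set"
  assumes "identifying_code hex_vertices hex_edges 2 C"
  shows "density C \<ge> ereal (1 / 5)"
proof -
  let ?d = "\<lambda>m. real (card (C \<inter> square_box m)) / real (card (square_box m))"
  \<comment> \<open>Here 2m - 3 is the side of the box of radius m - 2, whose balls stay within the
    box of radius m; 2m + 1 is the side of the latter.\<close>
  let ?b = "\<lambda>m. ((2 * real m - 3) / (2 * real m + 1))\<^sup>2 / 5"
  have nonempty: "hex.ball2 v \<inter> C \<noteq> {}" for v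
    using assms unfolding identifying_code_def hex_ball_eq unfolding hex_vertices_def by blast
  have inj: "inj (\<lambda>v. hex.ball2 v \<inter> C)"
    using assms unfolding identifying_code_def hex_ball_eq unfolding hex_vertices_def inj_def
    by blast
  have fin: "finite (square_box m)" for m
    by (simp add: square_box_eq)
  have bound: "?b m \<le> ?d m" if m2: "2 \<le> m" for m
  proof -
    obtain k where m: "m = k + 2"
      using le_Suc_ex[OF m2] by (auto simp: add.commute)
    have "card (square_box k) \<le> 5 * card (C \<inter> square_box (k + 2))"
    proof (rule hex.card_le_5_code)
      show "hex.ball2 v \<inter> C \<noteq> {}" for v
        by (rule nonempty)
      show "hex.ball2 v \<subseteq> square_box (k + 2)" if "v \<in> square_box k" for v
        using that by (rule hex_ball2_subset_box)
    qed (rule inj fin)+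
    then have "real ((2 * k + 1)\<^sup>2) \<le> real (5 * card (C \<inter> square_box m))"
      unfolding m card_square_box of_nat_le_iff .
    moreover have "real ((2 * k + 1)\<^sup>2) = (2 * real m - 3)\<^sup>2"
      by (simp add: m)
    ultimately have "(2 * real m - 3)\<^sup>2 / 5 \<le> real (card (C \<inter> square_box m))"
      by (simp only: of_nat_mult of_nat_numeral)
    then have "(2 * real m - 3)\<^sup>2 / 5 / (2 * real m + 1)\<^sup>2
        \<le> real (card (C \<inter> square_box m)) / (2 * real m + 1)\<^sup>2"
      by (intro divide_right_mono) auto
    then show ?thesis
      by (simp add: card_square_box power_divide ac_simps)
  qed
  \<comment> \<open>The boundary layer of width 2 is negligible in the limit.\<close>
  have "?b \<longlonglongrightarrow> 1 / 5"
    by real_asymp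
  then have "(\<lambda>m. ereal (?b m)) \<longlonglongrightarrow> ereal (1 / 5)"
    by simp
  then have "ereal (1 / 5) = limsup (\<lambda>m. ereal (?b m))"
    by (intro lim_imp_Limsup[symmetric]) auto
  also have "\<dots> \<le> limsup (\<lambda>m. ereal (?d m))"
    using bound by (intro Limsup_mono eventually_sequentiallyI[of 2]) auto
  finally show ?thesis
    unfolding density_def .
qed

end
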